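(* Let $(X,\mathcal{F})$ be a measurable space with $\mathcal{F}$ countably generated, let $\mathcal{E}$ be a sub-$\sigma$-algebra of $\mathcal{F}$ (not necessarily countably generated), and let $\pi$ be an $\mathcal{E}$-measurable quasi-probability kernel. If $\mathcal{J}_{\mathcal{E}}(\pi)=\mathcal{J}_\star(\pi)$, then there exists a normal refinement $\varrho$ of $\pi$.
   Context: $\mathrm{P}(\mathcal{F})$ denotes the set of probability measures on $(X,\mathcal{F})$ and $\mathbb{R}^+=[0,\infty)$. A quasi-probability kernel is a mapping $\pi : X\times\mathcal{F}\to\mathbb{R}^+$ such that $\pi(\cdot,F)$ is $\mathcal{F}$-measurable for each $F\in\mathcal{F}$ and $\pi(x,\cdot)$ is a measure on $(X,\mathcal{F})$ with $\pi(x,X)\in\{0,1\}$ for each $x\in X$. It is $\mathcal{E}$-measurable if $\pi(\cdot,F)$ is $\mathcal{E}$-measurable for each $F\in\mathcal{F}$. Its support is $S_\pi=\{x\in X:\pi(x,X)=1\}$. For an $\mathcal{E}$-measurable quasi-probability kernel $\pi$ put $\mathcal{J}_{\mathcal{E}}(\pi)=\{\mu\in\mathrm{P}(\mathcal{F}) : \mu(E\cap F)=\int I_E\,\pi(\cdot,F)\,d\mu \text{ for all } E\in\mathcal{E},\ F\in\mathcal{F}\}$, where $I_E$ is the indicator function of $E$, and $\mathcal{J}_\star(\pi)=\{\mu\in\mathrm{P}(\mathcal{F}):\mu(F)=\int\pi(\cdot,F)\,d\mu\text{ for all }F\in\mathcal{F}\}$. A measure $\mu\in\mathrm{P}(\mathcal{F})$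 is trivial on $\mathcal{E}$ if $\mu(E)\in\{0,1\}$ for all $E\in\mathcal{E}$. The kernel $\pi$ is adapted if $\pi(x,\cdot)\in\mathcal{J}_{\mathcal{E}}(\pi)$ for all $x\in S_\pi$; it is normal if it is adapted and $\pi(x,\cdot)$ is trivial on $\mathcal{E}$ for all $x\in S_\pi$. For $D\in\mathcal{E}$ the restriction of $\pi$ to $D$ is the $\mathcal{E}$-measurable quasi-probability kernel $(x,F)\mapsto I_D(x)\pi(x,F)$. An $\mathcal{E}$-measurable quasi-probability kernel $\varrho$ is a refinement of $\pi$ if $\varrho$ is the restriction of $\pi$ to $D$ for some $D\in\mathcal{E}$ and $\mathcal{J}_{\mathcal{E}}(\varrho)=\mathcal{J}_{\mathcal{E}}(\pi)$. *)

theory Defs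
  imports "HOL-Probability.Probability"
begin

text \<open>
  A measurable space \<open>(X, \<F>)\<close> is represented by a measure \<open>F\<close>, of which only
  \<open>space F\<close> and \<open>sets F\<close> matter; likewise for the sub-\<open>\<sigma>\<close>-algebra \<open>E\<close> (with
  \<^term>\<open>subalgebra F E\<close>). The set of probability measures on \<open>F\<close> is
  \<^term>\<open>space (prob_algebra F)\<close>.
\<close>

definition countably_generated :: "'a measure \<Rightarrow> bool" where
  "countably_generated F \<longleftrightarrow>
     (\<exists>G. countable G \<and> G \<subseteq> Pow (space F) \<and> sets F = sigma_sets (space F) G)"

text \<open>
  A kernel \<open>\<pi>\<close> is given by the measures \<open>\<pi> x\<close>, with \<open>emeasure (\<pi> x) A\<close> in the role of
  \<open>\<pi>(x, A)\<close>; values of \<open>\<pi>\<close> outside \<open>space F\<close> are irrelevant. Since the total masses are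
  \<open>0\<close> or \<open>1\<close>, all values are finite although \<^const>\<open>emeasure\<close> is \<^typ>\<open>ennreal\<close>-valued.
\<close>

definition kernel_measurable :: "'a measure \<Rightarrow> 'a measure \<Rightarrow> ('a \<Rightarrow> 'a measure) \<Rightarrow> bool" where
  "kernel_measurable E F \<pi> \<longleftrightarrow>
     (\<forall>A\<in>sets F. (\<lambda>x. emeasure (\<pi> x) A) \<in> borel_measurable E)"

definition quasi_prob_kernel :: "'a measure \<Rightarrow> ('a \<Rightarrow> 'a measure) \<Rightarrow> bool" where
  "quasi_prob_kernel F \<pi> \<longleftrightarrow>
     kernel_measurable F F \<pi> \<and>
     (\<forall>x\<in>space F. sets (\<pi> x) = sets F \<and> emeasure (\<pi> x) (space F) \<in> {0, 1})"

definition kernel_support :: "'a measure \<Rightarrow> ('a \<Rightarrow> 'a measure) \<Rightarrow> 'a set" where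
  "kernel_support F \<pi> = {x \<in> space F. emeasure (\<pi> x) (space F) = 1}"

definition J_sub :: "'a measure \<Rightarrow> 'a measure \<Rightarrow> ('a \<Rightarrow> 'a measure) \<Rightarrow> 'a measure set" where
  "J_sub E F \<pi> = {\<mu> \<in> space (prob_algebra F).
     \<forall>B\<in>sets E. \<forall>A\<in>sets F.
       emeasure \<mu> (B \<inter> A) = (\<integral>\<^sup>+ x. indicator B x * emeasure (\<pi> x) A \<partial>\<mu>)}"

definition J_star :: "'a measure \<Rightarrow> ('a \<Rightarrow> 'a measure) \<Rightarrow> 'a measure set" where
  "J_star F \<pi> = {\<mu> \<in> space (prob_algebra F).
     \<forall>A\<in>sets F. emeasure \<mu> A = (\<integral>\<^sup>+ x. emeasure (\<pi> x) A \<partial>\<mu>)}"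

definition trivial_on :: "'a measure \<Rightarrow> 'a measure \<Rightarrow> bool" where
  "trivial_on E \<mu> \<longleftrightarrow> (\<forall>B\<in>sets E. emeasure \<mu> B \<in> {0, 1})"

definition adapted_kernel :: "'a measure \<Rightarrow> 'a measure \<Rightarrow> ('a \<Rightarrow> 'a measure) \<Rightarrow> bool" where
  "adapted_kernel E F \<pi> \<longleftrightarrow> (\<forall>x\<in>kernel_support F \<pi>. \<pi> x \<in> J_sub E F \<pi>)"

definition normal_kernel :: "'a measure \<Rightarrow> 'a measure \<Rightarrow> ('a \<Rightarrow> 'a measure) \<Rightarrow> bool" where
  "normal_kernel E F \<pi> \<longleftrightarrow>
     adapted_kernel E F \<pi> \<and> (\<forall>x\<in>kernel_support F \<pi>. trivial_on E (\<pi> x))"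

definition kernel_restrict :: "'a set \<Rightarrow> ('a \<Rightarrow> 'a measure) \<Rightarrow> 'a \<Rightarrow> 'a measure" where
  "kernel_restrict D \<pi> = (\<lambda>x. scale_measure (indicator D x) (\<pi> x))"

definition kernel_refinement ::
    "'a measure \<Rightarrow> 'a measure \<Rightarrow> ('a \<Rightarrow> 'a measure) \<Rightarrow> ('a \<Rightarrow> 'a measure) \<Rightarrow> bool" where
  "kernel_refinement E F \<pi> \<rho> \<longleftrightarrow>
     quasi_prob_kernel F \<rho> \<and> kernel_measurable E F \<rho> \<and>
     (\<exists>D\<in>sets E. \<forall>x\<in>space F. \<rho> x = kernel_restrict D \<pi> x) \<and>
     J_sub E F \<rho> = J_sub E F \<pi>"

end

theory Submission
  imports Defs
begin

text \<open>
  A measure \<open>\<mu>\<close> lies in \<^term>\<open>J_sub E F \<pi>\<close> exactly when \<open>\<pi>(\<cdot>, A)\<close> is a version of the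
  conditional probability \<open>\<mu>(A | E)\<close> for every \<open>A\<close>; consequently
  \<open>x \<mapsto> \<integral>f d\<pi>(x, \<cdot>)\<close> is a version of the conditional expectation of \<open>f\<close>. If \<open>f\<close> itself
  is \<open>E\<close>-measurable, this conditional expectation is \<open>f\<close>, so
  \[ \int f\,d\pi(x, \cdot) = f(x) \quad\mbox{for } \mu\mbox{-almost every } x \]
  (\<open>AE_nn_integral_kernel_eq\<close>). This is applied to \<open>f = \<pi>(\<cdot>, A)\<close> and to
  \<open>f = \<pi>(\<cdot>, A)\<^sup>2\<close>, with \<open>A\<close> ranging over a countable intersection-stable generator
  of \<open>F\<close>. Let \<open>D\<close> be the set of all \<open>x\<close> at which all these equations hold. It is in \<open>E\<close>
  and, as there are only countably many equations, it has full measure under every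
  \<open>\<mu>\<close> in \<^term>\<open>J_sub E F \<pi>\<close>, so restricting \<open>\<pi>\<close> to \<open>D\<close> does not
  change \<^term>\<open>J_sub E F \<pi>\<close> (\<open>J_sub_kernel_restrict\<close>).

  Let \<open>x\<close> be a point of \<open>D\<close> in the support of \<open>\<pi>\<close>. The first family of equations says
  that \<open>\<pi>(x, \<cdot>)\<close> is invariant under \<open>\<pi>\<close>, i.e. lies in \<^term>\<open>J_star F \<pi>\<close>, and the
  hypothesis \<^term>\<open>J_sub E F \<pi> = J_star F \<pi>\<close> puts it into \<^term>\<open>J_sub E F \<pi>\<close>. This
  is the only use of the hypothesis, and it yields adaptedness. The second family says that under
  \<open>\<pi>(x, \<cdot>)\<close> the random variable \<open>\<pi>(\<cdot>, A)\<close> has variance \<open>0\<close>, hence is almost surely equal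
  to its mean \<open>\<pi>(x, A)\<close>. The conditional probability of \<open>A\<close> given \<open>E\<close> being constant, \<open>E\<close> is
  independent of \<open>A\<close>, for all \<open>A\<close> in the generator and then for all \<open>A\<close> in \<open>F\<close>. So \<open>E\<close> is
  independent of itself, that is, \<open>\<pi>(x, \<cdot>)\<close> is trivial on \<open>E\<close>
  (\<open>trivial_on_if_squares_preserved\<close>).
\<close>

section \<open>Generators and variance\<close>

lemma countably_generated_Int_stable:
  assumes "countably_generated F"
  obtains G where "countable G" "Int_stable G" "space F \<in> G" "G \<subseteq> Pow (space F)"
    "sets F = sigma_sets (space F) G"
proof -
  obtain H where H: "countable H" "H \<subseteq> Pow (space F)" "sets F = sigma_sets (space F) H"
    using assms unfolding countably_generated_def by auto
  define cap where "cap K = space F \<inter> \<Inter>K" for K :: "'a set set"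
  define G where "G = cap ` {K. finite K \<and> K \<subseteq> H}"
  have "countable {K. finite K \<and> K \<subseteq> H}"
    using H(1) countable_Collect_finite_subset by auto
  then have "countable G" unfolding G_def by simp
  moreover have "Int_stable G"
  proof (rule Int_stableI)
    fix a b assume "a \<in> G" "b \<in> G"
    then obtain K L where KL: "a = cap K" "b = cap L" "finite K" "K \<subseteq> H" "finite L" "L \<subseteq> H"
      unfolding G_def by auto
    then have "a \<inter> b = cap (K \<union> L)" unfolding cap_def by auto
    then show "a \<inter> b \<in> G" using KL unfolding G_def by auto
  qed
  moreover have "space F \<in> G"
    unfolding G_def by (rule image_eqI[of _ _ "{}"]) (auto simp: cap_def)
  moreover have "G \<subseteq> Pow (space F)" unfolding G_def cap_def by auto
  moreover have "sets F = sigma_sets (space F) G"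
  proof
    have "H \<subseteq> G"
    proof
      fix h assume "h \<in> H"
      then show "h \<in> G" using H(2)
        unfolding G_def by (intro image_eqI[of _ _ "{h}"]) (auto simp: cap_def)
    qed
    then show "sets F \<subseteq> sigma_sets (space F) G"
      unfolding H(3) by (rule sigma_sets_mono')
    have "G \<subseteq> sets F"
    proof
      fix g assume "g \<in> G"
      then obtain K where K: "g = cap K" "finite K" "K \<subseteq> H" unfolding G_def by auto
      have "K \<subseteq> sets F" using K(3) H(3) by auto
      with K(2) have "cap K \<in> sets F"
        unfolding cap_def by (induction K rule: finite_induct) (auto simp: Int_left_commute)
      then show "g \<in> sets F" using K(1) by simp
    qed
    then show "sigma_sets (space F) G \<subseteq> sets F"
      by (rule sets.sigma_sets_subset)
  qed
  ultimately show ?thesis using that by blast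
qed

lemma (in prob_space) AE_const_if_second_moment:
  fixes g :: "'a \<Rightarrow> ennreal"
  assumes [measurable]: "g \<in> borel_measurable M"
    and le1: "\<And>x. x \<in> space M \<Longrightarrow> g x \<le> 1"
    and mean: "(\<integral>\<^sup>+ x. g x \<partial>M) = c"
    and square: "(\<integral>\<^sup>+ x. (g x)\<^sup>2 \<partial>M) = c\<^sup>2"
  shows "AE x in M. g x = c"
proof -
  define X where "X x = enn2real (g x)" for x
  have [measurable]: "X \<in> borel_measurable M" unfolding X_def by measurable
  have gX: "g x = ennreal (X x)" if "x \<in> space M" for x
    unfolding X_def using le1[OF that] by (simp add: le_less_trans)
  have X1: "0 \<le> X x" "X x \<le> 1" if "x \<in> space M" for x
    using le1[OF that] unfolding gX[OF that] by (auto simp: X_def)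
  have "(\<integral>\<^sup>+ x. g x \<partial>M) \<le> (\<integral>\<^sup>+ x. 1 \<partial>M)" by (intro nn_integral_mono le1)
  then have "c \<le> 1" using mean by (simp add: emeasure_space_1)
  then obtain d where d: "c = ennreal d" "0 \<le> d"
    by (cases c) (auto simp: top_unique)
  have int: "integrable M X"
    using X1 by (intro integrable_const_bound[of _ 1]) auto
  have int2: "integrable M (\<lambda>x. (X x)\<^sup>2)"
    using X1 by (intro integrable_const_bound[of _ 1]) (auto simp: power_le_one)
  have "expectation X = d"
    using mean d X1 by (intro integral_eq_nn_integral[THEN trans]) (auto simp: gX cong: nn_integral_cong)
  moreover have "expectation (\<lambda>x. (X x)\<^sup>2) = d\<^sup>2"
  proof (subst integral_eq_nn_integral)
    have "(\<integral>\<^sup>+ x. ennreal ((X x)\<^sup>2) \<partial>M) = (\<integral>\<^sup>+ x. (g x)\<^sup>2 \<partial>M)"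
      by (intro nn_integral_cong) (simp add: gX X1 ennreal_power)
    then show "enn2real (\<integral>\<^sup>+ x. ennreal ((X x)\<^sup>2) \<partial>M) = d\<^sup>2"
      using square d by (simp add: ennreal_power)
  qed auto
  ultimately have "variance X = 0" "expectation X = d"
    using variance_eq[OF int int2] by auto
  moreover have "integrable M (\<lambda>x. (X x - d)\<^sup>2)"
    using int int2 by (simp add: power2_diff)
  ultimately have "AE x in M. (X x - d)\<^sup>2 = 0"
    by (subst (asm) integral_nonneg_eq_0_iff_AE) auto
  then show ?thesis using AE_space by eventually_elim (auto simp: gX d)
qed

section \<open>Kernels as conditional probabilities\<close>

locale subalgebra_kernel =
  fixes F E :: "'a measure" and \<pi> :: "'a \<Rightarrow> 'a measure"
  assumes subalg: "subalgebra F E"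
    and quasi: "quasi_prob_kernel F \<pi>"
    and E_kernel: "kernel_measurable E F \<pi>"
begin

lemma space_E: "space E = space F"
  using subalg unfolding subalgebra_def by simp

lemma sets_E: "B \<in> sets E \<Longrightarrow> B \<in> sets F"
  using subalg unfolding subalgebra_def by auto

lemma sets_kernel: "x \<in> space F \<Longrightarrow> sets (\<pi> x) = sets F"
  using quasi unfolding quasi_prob_kernel_def by auto

lemma emeasure_kernel_le_1:
  assumes "x \<in> space F" shows "emeasure (\<pi> x) A \<le> 1"
proof -
  have "emeasure (\<pi> x) A \<le> emeasure (\<pi> x) (space F)"
    using sets_kernel[OF assms] by (metis emeasure_space sets_eq_imp_space_eq)
  also have "\<dots> \<le> 1"
    using quasi assms unfolding quasi_prob_kernel_def by auto
  finally show ?thesis .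
qed

lemma kernel_in_subprob_algebra: "\<pi> \<in> measurable E (subprob_algebra F)"
proof (rule measurable_subprob_algebra)
  fix x assume "x \<in> space E"
  then have x: "x \<in> space F" by (simp add: space_E)
  show "sets (\<pi> x) = sets F" by (rule sets_kernel[OF x])
  then show "subprob_space (\<pi> x)"
    using x emeasure_kernel_le_1[OF x] by (intro subprob_spaceI) (auto dest!: sets_eq_imp_space_eq)
qed (use E_kernel in \<open>auto simp: kernel_measurable_def\<close>)

lemma E_measurable_imp: "f \<in> measurable E N \<Longrightarrow> f \<in> measurable F N"
  using measurable_from_subalg[OF subalg] .

lemma kernel_measurable_from:
  "sets \<mu> = sets F \<Longrightarrow> \<pi> \<in> measurable \<mu> (subprob_algebra F)"
  using E_measurable_imp[OF kernel_in_subprob_algebra] by (simp cong: measurable_cong_sets)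

lemma emeasure_kernel_measurable:
  "A \<in> sets F \<Longrightarrow> (\<lambda>x. emeasure (\<pi> x) A) \<in> borel_measurable E"
  using E_kernel unfolding kernel_measurable_def by auto

lemma nn_integral_kernel_measurable:
  "f \<in> borel_measurable F \<Longrightarrow> (\<lambda>x. \<integral>\<^sup>+ y. f y \<partial>\<pi> x) \<in> borel_measurable E"
  using measurable_compose[OF kernel_in_subprob_algebra nn_integral_measurable_subprob_algebra]
  by auto

lemma kernel_support_prob:
  assumes "x \<in> kernel_support F \<pi>" shows "\<pi> x \<in> space (prob_algebra F)"
proof -
  have x: "x \<in> space F" "emeasure (\<pi> x) (space F) = 1"
    using assms unfolding kernel_support_def by auto
  then show ?thesis
    using sets_kernel[OF x(1)]
    by (auto simp: space_prob_algebra dest: sets_eq_imp_space_eq intro!: prob_spaceI)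
qed

lemma nn_integral_J_sub:
  assumes "\<mu> \<in> J_sub E F \<pi>" and B: "B \<in> sets E" and f: "f \<in> borel_measurable F"
  shows "(\<integral>\<^sup>+ x. indicator B x * f x \<partial>\<mu>) = (\<integral>\<^sup>+ x. indicator B x * (\<integral>\<^sup>+ y. f y \<partial>\<pi> x) \<partial>\<mu>)"
proof -
  have \<mu>: "sets \<mu> = sets F" "prob_space \<mu>"
    and J: "\<And>A. A \<in> sets F \<Longrightarrow> emeasure \<mu> (B \<inter> A) = (\<integral>\<^sup>+ x. indicator B x * emeasure (\<pi> x) A \<partial>\<mu>)"
    using assms unfolding J_sub_def space_prob_algebra by auto
  have ne: "space \<mu> \<noteq> {}" by (rule prob_space.not_empty[OF \<mu>(2)])
  let ?\<nu> = "density \<mu> (indicator B)"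
  have [measurable]: "B \<in> sets \<mu>" using \<mu>(1) sets_E[OF B] by simp
  have [measurable]: "f \<in> borel_measurable \<mu>" using f \<mu>(1) by (simp cong: measurable_cong_sets)
  have \<pi>\<nu>: "\<pi> \<in> measurable ?\<nu> (subprob_algebra F)"
    by (rule kernel_measurable_from) (simp add: \<mu>)
  have [measurable]: "(\<lambda>x. \<integral>\<^sup>+ y. f y \<partial>\<pi> x) \<in> borel_measurable \<mu>"
    using E_measurable_imp[OF nn_integral_kernel_measurable[OF f]] \<mu>(1)
    by (simp cong: measurable_cong_sets)
  \<comment> \<open>The defining identity of \<open>J_sub\<close> for a fixed \<open>B\<close> is invariance of \<open>\<mu>\<close>
    cut down to \<open>B\<close>; for measures, that extends from sets to functions.\<close>
  have "?\<nu> = ?\<nu> \<bind> \<pi>"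
  proof (rule measure_eqI)
    show "sets ?\<nu> = sets (?\<nu> \<bind> \<pi>)"
      using sets_bind[of ?\<nu> \<pi> F] ne \<mu>(1) by (simp add: sets_kernel sets_eq_imp_space_eq[OF \<mu>(1)])
    fix A assume "A \<in> sets ?\<nu>"
    then have [measurable]: "A \<in> sets F" "A \<in> sets \<mu>" using \<mu>(1) by auto
    have [measurable]: "(\<lambda>x. emeasure (\<pi> x) A) \<in> borel_measurable \<mu>"
      using E_measurable_imp[OF emeasure_kernel_measurable] \<mu>(1)
      by (simp cong: measurable_cong_sets)
    have "emeasure ?\<nu> A = emeasure \<mu> (B \<inter> A)"
      by (simp add: emeasure_density flip: indicator_inter_arith)
    also have "\<dots> = emeasure (?\<nu> \<bind> \<pi>) A"
      using ne by (simp add: J emeasure_bind[OF _ \<pi>\<nu>] nn_integral_density)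
    finally show "emeasure ?\<nu> A = emeasure (?\<nu> \<bind> \<pi>) A" .
  qed
  then have "(\<integral>\<^sup>+ x. f x \<partial>?\<nu>) = (\<integral>\<^sup>+ x. f x \<partial>(?\<nu> \<bind> \<pi>))" by simp
  then show ?thesis
    by (simp add: nn_integral_bind[OF f \<pi>\<nu>] nn_integral_density)
qed

text \<open>
  Both sides are \<open>E\<close>-measurable and, by the previous lemma, have the same integral over every
  set of \<open>E\<close>.
\<close>

lemma AE_nn_integral_kernel_eq:
  assumes \<mu>J: "\<mu> \<in> J_sub E F \<pi>" and f: "f \<in> borel_measurable E"
  shows "AE x in \<mu>. (\<integral>\<^sup>+ y. f y \<partial>\<pi> x) = f x"
proof -
  have \<mu>: "sets \<mu> = sets F" "prob_space \<mu>"
    using \<mu>J unfolding J_sub_def space_prob_algebra by auto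
  have sub: "subalgebra \<mu> E"
    using subalg \<mu>(1) sets_eq_imp_space_eq[OF \<mu>(1)] unfolding subalgebra_def by simp
  interpret \<mu>: prob_space \<mu> by fact
  let ?\<mu>' = "restr_to_subalg \<mu> E"
  interpret R: finite_measure ?\<mu>'
    by (rule finite_measure_restr_to_subalg[OF sub]) unfold_locales
  have f': "f \<in> borel_measurable F" by (rule E_measurable_imp[OF f])
  note [measurable] = f nn_integral_kernel_measurable[OF f']
  have R: "measurable ?\<mu>' N = measurable E N" for N :: "ennreal measure"
    by (rule measurable_cong_sets) (auto simp: sets_restr_to_subalg[OF sub])
  have "AE x in ?\<mu>'. (\<integral>\<^sup>+ y. f y \<partial>\<pi> x) = f x"
  proof (rule R.density_unique_finite_measure)
    show "(\<lambda>x. \<integral>\<^sup>+ y. f y \<partial>\<pi> x) \<in> borel_measurable ?\<mu>'" "f \<in> borel_measurable ?\<mu>'"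
      unfolding R by measurable
    show "AE x in ?\<mu>'. 0 \<le> (\<integral>\<^sup>+ y. f y \<partial>\<pi> x)" "AE x in ?\<mu>'. 0 \<le> f x" by simp_all
    fix B assume "B \<in> sets ?\<mu>'"
    then have [measurable]: "B \<in> sets E" by (simp add: sets_restr_to_subalg[OF sub])
    show "(\<integral>\<^sup>+ x. (\<integral>\<^sup>+ y. f y \<partial>\<pi> x) * indicator B x \<partial>?\<mu>') = (\<integral>\<^sup>+ x. f x * indicator B x \<partial>?\<mu>')"
      using nn_integral_J_sub[OF \<mu>J \<open>B \<in> sets E\<close> f']
      by (simp add: nn_integral_subalgebra2[OF sub] mult.commute)
  qed
  then show ?thesis by (rule AE_restr_to_subalg[OF sub])
qed

lemma J_sub_kernel_restrict:
  assumes D: "D \<in> sets E"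
    and full: "\<And>\<mu>. \<mu> \<in> J_sub E F \<pi> \<Longrightarrow> AE x in \<mu>. x \<in> D"
  shows "J_sub E F (kernel_restrict D \<pi>) = J_sub E F \<pi>"
proof -
  have iff: "\<mu> \<in> J_sub E F (kernel_restrict D \<pi>) \<longleftrightarrow> \<mu> \<in> J_sub E F \<pi>" if ae: "AE x in \<mu>. x \<in> D" for \<mu>
  proof -
    have "(\<integral>\<^sup>+ x. indicator B x * emeasure (kernel_restrict D \<pi> x) A \<partial>\<mu>)
        = (\<integral>\<^sup>+ x. indicator B x * emeasure (\<pi> x) A \<partial>\<mu>)" for A B
      using ae by (intro nn_integral_cong_AE) (auto simp: kernel_restrict_def elim!: eventually_mono)
    then show ?thesis unfolding J_sub_def by auto
  qed
  have "AE x in \<mu>. x \<in> D" if "\<mu> \<in> J_sub E F (kernel_restrict D \<pi>)" for \<mu>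
  proof -
    have \<mu>: "sets \<mu> = sets F" "prob_space \<mu>" "space \<mu> = space F"
      using that sets_eq_imp_space_eq unfolding J_sub_def space_prob_algebra by auto
    interpret \<mu>: prob_space \<mu> by fact
    have [measurable]: "D \<in> sets \<mu>" using sets_E[OF D] \<mu>(1) by simp
    \<comment> \<open>Testing with the whole space: the restricted kernel has no mass outside \<open>D\<close>.\<close>
    have "emeasure \<mu> (space F \<inter> space F)
        = (\<integral>\<^sup>+ x. indicator (space F) x * emeasure (kernel_restrict D \<pi> x) (space F) \<partial>\<mu>)"
      using that sets.top[of E] space_E unfolding J_sub_def by auto
    also have "\<dots> \<le> (\<integral>\<^sup>+ x. indicator D x \<partial>\<mu>)"
      by (intro nn_integral_mono)
        (auto simp: kernel_restrict_def \<mu>(3) emeasure_kernel_le_1 split: split_indicator)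
    finally have "1 \<le> emeasure \<mu> D" using \<mu>.emeasure_space_1 \<mu>(3) by simp
    then have "emeasure \<mu> D = 1" using \<mu>.emeasure_le_1 by (simp add: antisym)
    then show ?thesis by (simp add: \<mu>.AE_in_set_eq_1 \<mu>.emeasure_eq_measure)
  qed
  then show ?thesis using iff full by blast
qed

section \<open>Invariance and triviality of the kernel measures\<close>

lemma J_star_generator:
  assumes G: "Int_stable G" "space F \<in> G" "G \<subseteq> Pow (space F)" "sets F = sigma_sets (space F) G"
    and \<nu>: "\<nu> \<in> space (prob_algebra F)"
    and inv: "\<And>A. A \<in> G \<Longrightarrow> (\<integral>\<^sup>+ y. emeasure (\<pi> y) A \<partial>\<nu>) = emeasure \<nu> A"
  shows "\<nu> \<in> J_star F \<pi>"
proof -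
  have \<nu>': "sets \<nu> = sets F" "prob_space \<nu>" using \<nu> by (auto simp: space_prob_algebra)
  interpret prob_space \<nu> by fact
  have bind: "emeasure (\<nu> \<bind> \<pi>) A = (\<integral>\<^sup>+ y. emeasure (\<pi> y) A \<partial>\<nu>)" if "A \<in> sets F" for A
    by (rule emeasure_bind[OF not_empty kernel_measurable_from[OF \<nu>'(1)] that])
  have "\<nu> = \<nu> \<bind> \<pi>"
  proof (rule measure_eqI_generator_eq[OF G(1,3), of _ _ "\<lambda>_. space F"])
    show "sets (\<nu> \<bind> \<pi>) = sigma_sets (space F) G"
      unfolding G(4)[symmetric]
      by (rule sets_bind) (use \<nu>' not_empty sets_eq_imp_space_eq[OF \<nu>'(1)] in \<open>auto simp: sets_kernel\<close>)
    show "emeasure \<nu> A = emeasure (\<nu> \<bind> \<pi>) A" if "A \<in> G" for A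
      using that G(4) by (simp add: bind inv sigma_sets.Basic)
  qed (use G \<nu>' in auto)
  then show ?thesis using \<nu> bind unfolding J_star_def by auto
qed

text \<open>
  Preservation of \<open>\<pi>(\<cdot>, A)\<^sup>2\<close> makes the conditional probability of \<open>A\<close> almost surely
  constant, so \<open>E\<close> is independent of the generator, hence of \<open>F\<close>, hence of itself.
\<close>

lemma trivial_on_if_squares_preserved:
  assumes G: "Int_stable G" "space F \<in> G" "G \<subseteq> Pow (space F)" "sets F = sigma_sets (space F) G"
    and \<nu>J: "\<nu> \<in> J_sub E F \<pi>"
    and inv: "\<And>A. A \<in> G \<Longrightarrow> (\<integral>\<^sup>+ y. emeasure (\<pi> y) A \<partial>\<nu>) = emeasure \<nu> A"
    and sq: "\<And>A. A \<in> G \<Longrightarrow> (\<integral>\<^sup>+ y. (emeasure (\<pi> y) A)\<^sup>2 \<partial>\<nu>) = (emeasure \<nu> A)\<^sup>2"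
  shows "trivial_on E \<nu>"
  unfolding trivial_on_def
proof
  fix B assume B: "B \<in> sets E"
  have \<nu>: "sets \<nu> = sets F" "prob_space \<nu>" "space \<nu> = space F"
    and J: "\<And>A. A \<in> sets F \<Longrightarrow> emeasure \<nu> (B \<inter> A) = (\<integral>\<^sup>+ x. indicator B x * emeasure (\<pi> x) A \<partial>\<nu>)"
    using \<nu>J B sets_eq_imp_space_eq unfolding J_sub_def space_prob_algebra by auto
  interpret prob_space \<nu> by fact
  have [measurable]: "B \<in> sets \<nu>" using sets_E[OF B] \<nu>(1) by simp
  have indep: "emeasure \<nu> (B \<inter> A) = emeasure \<nu> B * emeasure \<nu> A" if A: "A \<in> G" for A
  proof -
    have AF: "A \<in> sets F" using A G(4) by auto
    have [measurable]: "(\<lambda>x. emeasure (\<pi> x) A) \<in> borel_measurable \<nu>"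
      using E_measurable_imp[OF emeasure_kernel_measurable[OF AF]] \<nu>(1)
      by (simp cong: measurable_cong_sets)
    have "AE y in \<nu>. emeasure (\<pi> y) A = emeasure \<nu> A"
      using \<nu>(3) by (intro AE_const_if_second_moment inv sq A) (auto simp: emeasure_kernel_le_1)
    then have "(\<integral>\<^sup>+ x. indicator B x * emeasure (\<pi> x) A \<partial>\<nu>) = (\<integral>\<^sup>+ x. indicator B x * emeasure \<nu> A \<partial>\<nu>)"
      by (intro nn_integral_cong_AE) (auto elim!: eventually_mono)
    then show ?thesis by (simp add: J[OF AF] nn_integral_multc)
  qed
  let ?\<nu>B = "density \<nu> (indicator B)" and ?\<nu>c = "scale_measure (emeasure \<nu> B) \<nu>"
  have dens: "emeasure ?\<nu>B A = emeasure \<nu> (B \<inter> A)" if "A \<in> sets F" for A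
    using that \<nu>(1) sets_E[OF B] by (simp add: emeasure_density flip: indicator_inter_arith)
  have "?\<nu>B = ?\<nu>c"
  proof (rule measure_eqI_generator_eq[OF G(1,3), of _ _ "\<lambda>_. space F"])
    show "emeasure ?\<nu>B A = emeasure ?\<nu>c A" if "A \<in> G" for A
      using that G(4) by (simp add: dens indep sigma_sets.Basic)
    show "emeasure ?\<nu>B (space F) \<noteq> \<infinity>" for i :: nat
      by (simp add: dens)
  qed (use G \<nu> in auto)
  then have "emeasure ?\<nu>B B = emeasure ?\<nu>c B" by simp
  then have "emeasure \<nu> B = emeasure \<nu> B * emeasure \<nu> B" by (simp add: dens sets_E[OF B])
  then have "prob B = prob B * prob B"
    by (simp add: emeasure_eq_measure flip: ennreal_mult)
  then show "emeasure \<nu> B \<in> {0, 1}" by (auto simp: emeasure_eq_measure)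
qed

end

section \<open>The normal refinement\<close>

theorem theorem2:
  fixes F E :: "'a measure" and \<pi> :: "'a \<Rightarrow> 'a measure"
  assumes "countably_generated F"
    and "subalgebra F E"
    and "quasi_prob_kernel F \<pi>"
    and "kernel_measurable E F \<pi>"
    and "J_sub E F \<pi> = J_star F \<pi>"
  shows "\<exists>\<rho>. kernel_refinement E F \<pi> \<rho> \<and> normal_kernel E F \<rho>"
proof -
  interpret subalgebra_kernel F E \<pi>
    using assms by unfold_locales
  obtain G where G: "countable G" "Int_stable G" "space F \<in> G" "G \<subseteq> Pow (space F)"
    "sets F = sigma_sets (space F) G"
    using countably_generated_Int_stable[OF assms(1)] .
  have GF: "A \<in> sets F" if "A \<in> G" for A using that G(5) by auto
  define P where "P x A \<longleftrightarrow> (\<integral>\<^sup>+ y. emeasure (\<pi> y) A \<partial>\<pi> x) = emeasure (\<pi> x) A \<and>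
    (\<integral>\<^sup>+ y. (emeasure (\<pi> y) A)\<^sup>2 \<partial>\<pi> x) = (emeasure (\<pi> x) A)\<^sup>2" for x A
  define D where "D = {x \<in> space E. \<forall>A\<in>G. P x A}"
  define \<rho> where "\<rho> = kernel_restrict D \<pi>"
  have D: "D \<in> sets E"
    unfolding D_def
  proof (rule sets.sets_Collect_countable_All'[OF _ G(1)])
    fix A assume "A \<in> G"
    note [measurable] = emeasure_kernel_measurable[OF GF[OF this]]
    have [measurable]: "(\<lambda>x. \<integral>\<^sup>+ y. emeasure (\<pi> y) A \<partial>\<pi> x) \<in> borel_measurable E"
      "(\<lambda>x. \<integral>\<^sup>+ y. (emeasure (\<pi> y) A)\<^sup>2 \<partial>\<pi> x) \<in> borel_measurable E"
      by (intro nn_integral_kernel_measurable E_measurable_imp; measurable)+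
    show "{x \<in> space E. P x A} \<in> sets E" unfolding P_def by measurable
  qed
  have full: "AE x in \<mu>. x \<in> D" if "\<mu> \<in> J_sub E F \<pi>" for \<mu>
  proof -
    have sp: "space \<mu> = space E"
      using that space_E unfolding J_sub_def space_prob_algebra by (auto dest: sets_eq_imp_space_eq)
    have "AE x in \<mu>. P x A" if A: "A \<in> G" for A
    proof -
      note [measurable] = emeasure_kernel_measurable[OF GF[OF A]]
      show ?thesis
        unfolding P_def AE_conj_iff
        by (intro conjI AE_nn_integral_kernel_eq \<open>\<mu> \<in> J_sub E F \<pi>\<close>) measurable
    qed
    then have "AE x in \<mu>. \<forall>A\<in>G. P x A" by (simp add: AE_ball_countable[OF G(1)])
    then show ?thesis using AE_space by eventually_elim (simp add: D_def sp)
  qed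
  have J: "J_sub E F \<rho> = J_sub E F \<pi>"
    unfolding \<rho>_def by (rule J_sub_kernel_restrict[OF D full])
  have \<rho>E: "kernel_measurable E F \<rho>"
    unfolding kernel_measurable_def
  proof
    fix A assume "A \<in> sets F"
    note [measurable] = emeasure_kernel_measurable[OF this] D
    show "(\<lambda>x. emeasure (\<rho> x) A) \<in> borel_measurable E"
      unfolding \<rho>_def kernel_restrict_def by simp
  qed
  then have "kernel_measurable F F \<rho>"
    unfolding kernel_measurable_def using E_measurable_imp by blast
  then have "quasi_prob_kernel F \<rho>"
    using quasi unfolding quasi_prob_kernel_def
    by (auto simp: \<rho>_def kernel_restrict_def split: split_indicator)
  then have "kernel_refinement E F \<pi> \<rho>"
    unfolding kernel_refinement_def using \<rho>E J D \<rho>_def by auto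
  moreover have "normal_kernel E F \<rho>"
  proof -
    have "\<rho> x \<in> J_sub E F \<rho> \<and> trivial_on E (\<rho> x)" if "x \<in> kernel_support F \<rho>" for x
    proof -
      have xD: "x \<in> D" and xS: "x \<in> kernel_support F \<pi>"
        using that by (auto simp: kernel_support_def \<rho>_def kernel_restrict_def split: split_indicator_asm)
      have "P x A" if "A \<in> G" for A using xD that unfolding D_def by auto
      then have inv: "\<And>A. A \<in> G \<Longrightarrow> (\<integral>\<^sup>+ y. emeasure (\<pi> y) A \<partial>\<pi> x) = emeasure (\<pi> x) A"
        and sq: "\<And>A. A \<in> G \<Longrightarrow> (\<integral>\<^sup>+ y. (emeasure (\<pi> y) A)\<^sup>2 \<partial>\<pi> x) = (emeasure (\<pi> x) A)\<^sup>2"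
        unfolding P_def by auto
      have "\<pi> x \<in> J_star F \<pi>"
        by (rule J_star_generator[OF G(2-5) kernel_support_prob[OF xS] inv])
      then have \<pi>J: "\<pi> x \<in> J_sub E F \<pi>" using assms(5) by simp
      have "trivial_on E (\<pi> x)"
        by (rule trivial_on_if_squares_preserved[OF G(2-5) \<pi>J inv sq])
      moreover have "\<rho> x = \<pi> x"
        using xD by (simp add: \<rho>_def kernel_restrict_def scale_measure_1)
      ultimately show ?thesis using \<pi>J J by simp
    qed
    then show ?thesis unfolding normal_kernel_def adapted_kernel_def by auto
  qed
  ultimately show ?thesis by blast
qed

end
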